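(* Let $p$ be an odd prime, $r\ge1$, and let $g,h$ be functions $\mathbb{F}_{p^{2r}}\to\mathbb{F}_{p^{2r}}$. Let $f(x)=g(x)+(g(x))^{p^r}+h(x)-(h(x))^{p^r}$. Then $f$ is a planar function if and only if for all $x\in\mathbb{F}_{p^{2r}}$ and all $a,b\in\mathbb{F}_{p^{2r}}^*$, the equality $$\Delta_{\Delta_{g,a},b}(x)+\left(\Delta_{\Delta_{g,a},b}(x)\right)^{p^r}=0$$ implies that $\Delta_{\Delta_{h,a},b}(x)\notin\mathbb{F}_{p^r}$.
   Context: For a function $u$ on a field and an element $a$, $\Delta_{u,a}(x)=u(x+a)-u(x)$; thus $\Delta_{\Delta_{u,a},b}(x)=\Delta_{u,a}(x+b)-\Delta_{u,a}(x)$. A function $f:\mathbb{F}_q\to\mathbb{F}_q$ is planar if $\Delta_{f,a}$ is a bijection for every $a\in\mathbb{F}_q^*$. $\mathbb{F}_{p^r}$ is regarded as the subfield of $\mathbb{F}_{p^{2r}}$. *)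

theory Defs
  imports "HOL-Computational_Algebra.Computational_Algebra" "HOL-Library.Cardinality"
begin

definition Delta :: "('a::ring \<Rightarrow> 'a) \<Rightarrow> 'a \<Rightarrow> 'a \<Rightarrow> 'a"
  where "Delta u a x = u (x + a) - u x"

definition planar :: "('a::finite_field \<Rightarrow> 'a) \<Rightarrow> bool"
  where "planar f \<longleftrightarrow> (\<forall>a. a \<noteq> 0 \<longrightarrow> bij (Delta f a))"

definition is_subfield :: "'a::field set \<Rightarrow> bool"
  where "is_subfield K \<longleftrightarrow>
    0 \<in> K \<and> 1 \<in> K \<and>
    (\<forall>x\<in>K. \<forall>y\<in>K. x + y \<in> K) \<and> (\<forall>x\<in>K. - x \<in> K) \<and>
    (\<forall>x\<in>K. \<forall>y\<in>K. x * y \<in> K) \<and> (\<forall>x\<in>K. x \<noteq> 0 \<longrightarrow> inverse x \<in> K)"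

end

theory Submission
  imports Defs "HOL-Number_Theory.Residues"
begin

text \<open>
  Write \<open>q = p ^ r\<close>. On a finite field, \<open>f\<close> is planar iff its second differences in nonzero
  directions never vanish. By additivity of the Frobenius map, the second difference of \<open>f\<close> is
  \<open>A + B\<close> with \<open>A = G + G ^ q\<close> and \<open>B = H - H ^ q\<close>, where \<open>G\<close>, \<open>H\<close> are those of \<open>g\<close>, \<open>h\<close>.
  Since \<open>A ^ q = A\<close>, \<open>B ^ q = - B\<close> and the characteristic is odd, \<open>A + B = 0\<close> iff \<open>A = B = 0\<close>;
  and \<open>H ^ q = H\<close> characterises membership in the subfield of order \<open>q\<close>.
\<close>

text \<open>For nonzero \<open>x\<close>, multiplication by \<open>x\<close> permutes
  \<open>K - {0}\<close>. Comparing the product of all nonzero elements before and after and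
  cancelling it leaves \<open>x ^ (card K - 1) = 1\<close>.\<close>

lemma subfield_power_card_eq_same:
  fixes K :: "'a::field set"
  assumes "is_subfield K" and "finite K" and "x \<in> K"
  shows "x ^ card K = x"
proof (cases "x = 0")
  case True
  have "card K > 0" using assms by (auto simp: card_gt_0_iff)
  with True show ?thesis by simp
next
  case False
  have K: "0 \<in> K" "\<And>u v. u \<in> K \<Longrightarrow> v \<in> K \<Longrightarrow> u * v \<in> K" "inverse x \<in> K"
    using assms False by (auto simp: is_subfield_def)
  have "(\<Prod>y\<in>K-{0}. x * y) = (\<Prod>y\<in>K-{0}. y)"
    by (rule prod.reindex_bij_witness[of _ "\<lambda>y. y * inverse x" "\<lambda>y. x * y"])
      (use False K assms(3) in auto)
  moreover have "(\<Prod>y\<in>K-{0}. x * y) = x ^ card (K - {0}) * \<Prod>(K-{0})"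
    by (simp add: prod.distrib)
  moreover have "\<Prod>(K-{0}) \<noteq> 0" using assms(2) by simp
  ultimately have "x ^ card (K - {0}) = 1" by simp
  moreover have "card K = Suc (card (K - {0}))"
    using K(1) assms(2) by (metis card_Suc_Diff1)
  ultimately show ?thesis by simp
qed

text \<open>The polynomial \<open>X ^ n - X\<close> with \<open>n = card K\<close> has at most
  \<open>n\<close> roots, and the elements of \<open>K\<close> already supply that many.\<close>

lemma mem_subfield_iff_power_card:
  fixes K :: "'a::field set"
  assumes "is_subfield K" and "finite K"
  shows "x \<in> K \<longleftrightarrow> x ^ card K = x"
proof -
  let ?n = "card K"
  define P :: "'a poly" where "P = Polynomial.monom 1 ?n - Polynomial.monom 1 1"
  \<comment> \<open>Having \<open>?n \<ge> 2\<close> keeps the two monomials of \<open>P\<close>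
    from cancelling.\<close>
  have "{0, 1} \<subseteq> K" using assms(1) by (auto simp: is_subfield_def)
  then have n: "?n \<ge> 2" using card_mono[OF assms(2), of "{0, 1}"] by simp
  then have "Polynomial.coeff P ?n = 1" by (simp add: P_def)
  then have P: "P \<noteq> 0" by auto
  have "Polynomial.degree P \<le> ?n"
    unfolding P_def using n by (intro degree_diff_le) (auto simp: degree_monom_eq)
  moreover have roots: "poly P y = 0 \<longleftrightarrow> y ^ ?n = y" for y
    by (simp add: P_def poly_monom)
  ultimately have "card {y :: 'a. y ^ ?n = y} \<le> ?n"
    using card_poly_roots_bound[OF P] by simp
  moreover have "finite {y :: 'a. y ^ ?n = y}"
    using poly_roots_finite[OF P] by (simp add: roots)
  moreover have "K \<subseteq> {y :: 'a. y ^ ?n = y}"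
    using subfield_power_card_eq_same[OF assms] by blast
  ultimately have "K = {y :: 'a. y ^ ?n = y}" by (metis card_seteq)
  then show ?thesis by blast
qed

text \<open>On a finite type bijectivity reduces to injectivity, and a collision
  \<open>u x = u y\<close> is a zero of the difference of \<open>u\<close> in direction
  \<open>y - x\<close>. This is applied to \<open>u = Delta f a\<close>.\<close>

lemma planar_iff_second_difference_nonzero:
  "planar f \<longleftrightarrow> (\<forall>x a b. a \<noteq> 0 \<longrightarrow> b \<noteq> 0 \<longrightarrow> Delta (Delta f a) b x \<noteq> 0)"
proof -
  have "bij u \<longleftrightarrow> (\<forall>x b. b \<noteq> 0 \<longrightarrow> Delta u b x \<noteq> 0)" for u :: "'a \<Rightarrow> 'a"
  proof -
    have "bij u \<longleftrightarrow> inj u"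
      using finite_UNIV_inj_surj[of u] by (auto simp: bij_def)
    also have "\<dots> \<longleftrightarrow> (\<forall>x b. b \<noteq> 0 \<longrightarrow> Delta u b x \<noteq> 0)"
    proof
      assume "inj u"
      then show "\<forall>x b. b \<noteq> 0 \<longrightarrow> Delta u b x \<noteq> 0"
        by (auto simp: Delta_def inj_eq)
    next
      assume *: "\<forall>x b. b \<noteq> 0 \<longrightarrow> Delta u b x \<noteq> 0"
      show "inj u"
      proof (rule injI)
        fix x y assume "u x = u y"
        then have "Delta u (y - x) x = 0" by (simp add: Delta_def)
        with * show "x = y" by (metis eq_iff_diff_eq_0)
      qed
    qed
    finally show ?thesis .
  qed
  then show ?thesis unfolding planar_def by blast
qed

lemma CHAR_eq_if_CARD_prime_power:
  assumes "prime p" and "CARD('a::finite_field) = p ^ n"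
  shows "CHAR('a) = p"
proof -
  have "prime CHAR('a)" by (rule prime_CHAR_semidom) (simp add: finite_imp_CHAR_pos)
  moreover have "CHAR('a) dvd p ^ n" using CHAR_dvd_CARD[where 'a='a] assms(2) by simp
  ultimately show ?thesis using assms(1) by (metis prime_dvd_power primes_dvd_imp_eq)
qed

theorem theorem2:
  fixes p r :: nat
    and K :: "'a::finite_field set"
    and f g h :: "'a \<Rightarrow> 'a"
  assumes "prime p" and "odd p" and "r \<ge> 1"
    and "CARD('a) = p ^ (2 * r)"
    and "is_subfield K" and "card K = p ^ r"
    and "\<And>x. f x = g x + (g x) ^ (p ^ r) + h x - (h x) ^ (p ^ r)"
  shows "planar f \<longleftrightarrow>
    (\<forall>x a b. a \<noteq> 0 \<longrightarrow> b \<noteq> 0 \<longrightarrow>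
      Delta (Delta g a) b x + (Delta (Delta g a) b x) ^ (p ^ r) = 0 \<longrightarrow>
      Delta (Delta h a) b x \<notin> K)"
proof -
  define F :: "'a \<Rightarrow> 'a" where "F x = x ^ (p ^ r)" for x
  have char: "CHAR('a) = p"
    using assms(1,4) by (rule CHAR_eq_if_CARD_prime_power)
  have F_add: "F (x + y) = F x + F y" for x y
    unfolding F_def using assms(1) char by (intro freshmans_dream') auto
  have F_diff: "F (x - y) = F x - F y" for x y
    using F_add[of "x - y" y] by (simp add: algebra_simps)
  \<comment> \<open>\<open>F\<close> is an involution because the square of \<open>p ^ r\<close> is
    the order of the whole field.\<close>
  have F_F: "F (F x) = x" for x
  proof -
    have "F (F x) = x ^ CARD('a)"
      by (simp add: F_def assms(4) mult_2 power_add power_mult)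
    then show ?thesis by (simp add: finite_field_power_card_eq_same)
  qed
  have "\<not> p dvd 2"
    using assms(1,2) by (metis primes_dvd_imp_eq two_is_prime_nat)
  then have two: "(2 :: 'a) \<noteq> 0"
    using of_nat_eq_0_iff_char_dvd[where 'a='a, of 2] char by simp
  \<comment> \<open>Here \<open>A\<close> and \<open>B\<close> stand for the second differences of
    \<open>g\<close> and \<open>h\<close> themselves. Applying \<open>F\<close> flips only the sign
    of \<open>B - F B\<close>, so a vanishing sum forces \<open>2 * (B - F B) = 0\<close>.\<close>
  have split: "A + F A + (B - F B) = 0 \<longleftrightarrow> A + F A = 0 \<and> F B = B" for A B
  proof
    assume *: "A + F A + (B - F B) = 0"
    have "F (A + F A + (B - F B)) = A + F A - (B - F B)"
      by (simp add: F_add F_diff F_F)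
    moreover have "F 0 = 0" using F_diff[of 0 0] by simp
    ultimately have "A + F A = B - F B" using * by simp
    with * have "2 * (B - F B) = 0" by (simp only: mult_2)
    with two have "B - F B = 0" by simp
    with * show "A + F A = 0 \<and> F B = B" by simp
  qed simp
  have K: "x \<in> K \<longleftrightarrow> F x = x" for x
    using mem_subfield_iff_power_card[OF assms(5), of x] by (simp add: assms(6) F_def)
  have "f = (\<lambda>x. g x + F (g x) + (h x - F (h x)))"
    using assms(7) by (auto simp: F_def)
  then have "Delta (Delta f a) b x =
      Delta (Delta g a) b x + F (Delta (Delta g a) b x)
      + (Delta (Delta h a) b x - F (Delta (Delta h a) b x))" for a b x
    by (simp add: Delta_def F_diff)
  then show ?thesis
    unfolding planar_iff_second_difference_nonzero F_def[symmetric]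
    by (auto simp: split K)
qed

end
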